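(* Let $n\ge 7$ and let $\mathcal{D}_n=(Q,\Sigma,\delta,0,F)$ be a minimal complete DFA with $n$ states accepting a suffix-free language, with transition semigroup $T(n)$. If $|\Sigma|<5$, then $|T(n)|<(n-1)^{n-2}+n-2$.
   Context: A language $L$ is suffix-free if whenever $w\in L$ and $u\in L$ with $u$ a suffix of $w$, then $u=w$. The transition semigroup of a DFA is the semigroup of transformations of its state set generated by the transformations induced by its letters. *)

theory Defs
  imports Main "HOL-Library.Sublist" "HOL-Library.FuncSet"
begin

fun delta_star :: "('q \<Rightarrow> 'a \<Rightarrow> 'q) \<Rightarrow> 'q \<Rightarrow> 'a list \<Rightarrow> 'q" where
  "delta_star \<delta> q [] = q"
| "delta_star \<delta> q (a # w) = delta_star \<delta> (\<delta> q a) w"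

definition complete_dfa :: "'q set \<Rightarrow> 'a set \<Rightarrow> ('q \<Rightarrow> 'a \<Rightarrow> 'q) \<Rightarrow> 'q \<Rightarrow> 'q set \<Rightarrow> bool" where
  "complete_dfa Q \<Sigma> \<delta> q0 F \<longleftrightarrow> finite Q \<and> finite \<Sigma> \<and> q0 \<in> Q \<and> F \<subseteq> Q \<and>
     (\<forall>q\<in>Q. \<forall>a\<in>\<Sigma>. \<delta> q a \<in> Q)"

definition dfa_lang :: "'a set \<Rightarrow> ('q \<Rightarrow> 'a \<Rightarrow> 'q) \<Rightarrow> 'q \<Rightarrow> 'q set \<Rightarrow> 'a list set" where
  "dfa_lang \<Sigma> \<delta> q0 F = {w. set w \<subseteq> \<Sigma> \<and> delta_star \<delta> q0 w \<in> F}"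

definition minimal_dfa :: "'q set \<Rightarrow> 'a set \<Rightarrow> ('q \<Rightarrow> 'a \<Rightarrow> 'q) \<Rightarrow> 'q \<Rightarrow> 'q set \<Rightarrow> bool" where
  "minimal_dfa Q \<Sigma> \<delta> q0 F \<longleftrightarrow>
     (\<forall>q\<in>Q. \<exists>w. set w \<subseteq> \<Sigma> \<and> delta_star \<delta> q0 w = q) \<and>
     (\<forall>p\<in>Q. \<forall>q\<in>Q. p \<noteq> q \<longrightarrow>
        (\<exists>w. set w \<subseteq> \<Sigma> \<and> (delta_star \<delta> p w \<in> F \<longleftrightarrow> delta_star \<delta> q w \<notin> F)))"

definition suffix_free :: "'a list set \<Rightarrow> bool" where
  "suffix_free L \<longleftrightarrow> (\<forall>w\<in>L. \<forall>u\<in>L. suffix u w \<longrightarrow> u = w)"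

definition trans_semigroup :: "'q set \<Rightarrow> 'a set \<Rightarrow> ('q \<Rightarrow> 'a \<Rightarrow> 'q) \<Rightarrow> ('q \<Rightarrow> 'q) set" where
  "trans_semigroup Q \<Sigma> \<delta> =
     {restrict (\<lambda>q. delta_star \<delta> q w) Q | w. w \<noteq> [] \<and> set w \<subseteq> \<Sigma>}"

end

theory Submission
  imports Complex_Main Defs
begin

text \<open>
  Let \<open>M\<close> be the set of the \<open>m = n - 2\<close> states other than the initial state and the empty
  state (\<open>sink\<close>). Call two states of \<open>M\<close> colliding if some word sends the initial state to one of
  them and a state of \<open>M\<close> to the other. By suffix-freeness, no word maps a colliding pair to
  a single state of \<open>M\<close>, and an image pair that avoids \<open>sink\<close> collides again. So every element
  of the semigroup is a homomorphism from the cone over the collision graph \<open>G\<close> (with the initial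
  state as apex) to \<open>G\<close> with a looped universal vertex \<open>sink\<close> added.

  If \<open>G\<close> has an edge, there are at most \<open>(m + 1) ^ m\<close> such homomorphisms. Restrict them to
  a largest clique of \<open>G\<close>, of size \<open>r\<close>, and count with a Turan-type bound for maps of cliques
  into graphs without \<open>(r + 1)\<close>-cliques; \<open>r = 2\<close> and \<open>r = 3\<close> need the degrees as well.

  If \<open>G\<close> has no edge, there are at most \<open>(m + 1) ^ m + m\<close> of them, and equality forces every
  partial transformation of \<open>M\<close> to occur. That takes two permutation letters, a total non-injective
  letter and an injective non-total letter, plus a letter that moves the initial state into \<open>M\<close>.
\<close>

section \<open>The numerical bound\<close>

text \<open>Convexity of the \<open>j\<close>-th power: its graph lies above the tangent at
  \<open>a\<close>. Multiplying the induction hypothesis by \<open>y\<close> leaves the next tangent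
  plus a nonnegative multiple of the square of \<open>y - a\<close>.\<close>

lemma power_tangent:
  fixes a y :: real
  assumes "0 \<le> a" "0 \<le> y"
  shows "a ^ j + real j * a ^ (j - 1) * (y - a) \<le> y ^ j"
proof (induction j)
  case (Suc j)
  have sq: "0 \<le> real j * a ^ (j - 1) * (y - a)\<^sup>2"
    using assms by simp
  have "y * (a ^ j + real j * a ^ (j - 1) * (y - a)) \<le> y * y ^ j"
    using Suc assms by (intro mult_left_mono) auto
  moreover have "y * (a ^ j + real j * a ^ (j - 1) * (y - a))
      = a ^ Suc j + real (Suc j) * a ^ j * (y - a) + real j * a ^ (j - 1) * (y - a)\<^sup>2"
    by (cases j) (auto simp: algebra_simps power2_eq_square)
  ultimately show ?case using sq by simp
qed simp

lemma real_choose_two: "real (n choose 2) = real n * (real n - 1) / 2"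
  by (induction n) (simp_all add: numeral_2_eq_2 field_simps)

section \<open>Falling factorials and the Turan-type clique bound\<close>

definition falling :: "nat \<Rightarrow> nat \<Rightarrow> real" where
  "falling r j = (\<Prod>i<j. real r - real i)"

lemma falling_0 [simp]: "falling r 0 = 1"
  by (simp add: falling_def)

lemma falling_Suc: "falling r (Suc j) = falling r j * (real r - real j)"
  by (simp add: falling_def)

lemma falling_Suc_Suc: "falling (Suc r) (Suc j) = real (Suc r) * falling r j"
  unfolding falling_def by (subst prod.lessThan_Suc_shift) simp

lemma falling_eq_0: "r < j \<Longrightarrow> falling r j = 0"
  by (auto simp: falling_def)

lemma falling_nonneg: "0 \<le> falling r j"
proof (cases "r < j")
  case False
  then show ?thesis unfolding falling_def by (intro prod_nonneg) auto
qed (simp add: falling_eq_0)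

lemma falling_self: "falling r r = fact r"
  by (induction r) (simp_all add: falling_Suc_Suc)

text \<open>
  The \<open>j\<close>-th term counts, in a balanced complete \<open>r\<close>-partite graph on \<open>x\<close> vertices, the maps of an
  \<open>s\<close>-clique that send \<open>j\<close> vertices injectively to a clique and the rest to the looped universal vertex.
  For \<open>r = 0\<close> only \<open>x = 0\<close> is meaningful.
\<close>

definition clique_bound :: "nat \<Rightarrow> nat \<Rightarrow> real \<Rightarrow> real" where
  "clique_bound r s x = (\<Sum>j\<le>s. real (s choose j) * (falling r j * (x / real r) ^ j))"

lemma clique_bound_mono:
  "0 \<le> x \<Longrightarrow> x \<le> y \<Longrightarrow> clique_bound r s x \<le> clique_bound r s y"
  unfolding clique_bound_def
  by (intro sum_mono mult_left_mono power_mono divide_right_mono falling_nonneg) auto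

lemma clique_bound_at_0 [simp]: "clique_bound r s 0 = 1"
proof -
  have "clique_bound r s 0 = (\<Sum>j\<le>s. if j = 0 then 1 else 0)"
    unfolding clique_bound_def by (intro sum.cong) auto
  then show ?thesis by simp
qed

text \<open>The inductive step of the Turan-type count: a new part of \<open>b\<close> vertices
  joins \<open>r\<close> equal parts of total size \<open>d\<close>, and evening out the
  \<open>r + 1\<close> parts can only increase the bound. The second summand on the left counts the
  choice of one of \<open>s\<close> positions, of one new vertex for it, and of a map on the other
  positions. The hypothesis on \<open>r = 0\<close> gives \<open>d = real r * a\<close> although
  \<open>a\<close> is then a division by zero.\<close>

lemma clique_bound_step:
  assumes "0 \<le> d" "0 \<le> b" "r = 0 \<longrightarrow> d = 0"
  shows "clique_bound r s d + real s * b * clique_bound r (s - 1) d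
         \<le> clique_bound (Suc r) s (d + b)"
proof (cases s)
  case 0
  then show ?thesis by (simp add: clique_bound_def)
next
  case (Suc t)
  define a where "a = d / real r"
  define y where "y = (d + b) / real (Suc r)"
  have a: "0 \<le> a" "0 \<le> y" using assms by (auto simp: a_def y_def)
  have d: "d = real r * a" using assms by (auto simp: a_def)
  \<comment> \<open>The comparison is made for each \<open>j\<close> separately. Without the common
    factor \<open>falling r j\<close> it is the tangent inequality for the power
    \<open>Suc j\<close> at the old part size \<open>a\<close>, evaluated at the new part size
    \<open>y\<close>, because \<open>real (Suc r) * (y - a) = b - a\<close>.\<close>
  have key: "falling r (Suc j) * a ^ Suc j + real (Suc j) * b * (falling r j * a ^ j)
      \<le> falling (Suc r) (Suc j) * y ^ Suc j" for j
  proof -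
    have y: "real (Suc r) * (y - a) = b - a"
      by (simp add: y_def d field_simps)
    have "(real r - real j) * a ^ Suc j + real (Suc j) * b * a ^ j
        = real (Suc r) * a ^ Suc j + real (Suc j) * a ^ j * (real (Suc r) * (y - a))"
      unfolding y by (simp add: algebra_simps)
    also have "\<dots> = real (Suc r) * (a ^ Suc j + real (Suc j) * a ^ j * (y - a))"
      by (simp only: distrib_left mult.assoc mult.left_commute)
    also have "\<dots> \<le> real (Suc r) * y ^ Suc j"
      using power_tangent[OF a, of "Suc j"] by (intro mult_left_mono) auto
    finally have "falling r j * ((real r - real j) * a ^ Suc j + real (Suc j) * b * a ^ j)
        \<le> falling r j * (real (Suc r) * y ^ Suc j)"
      by (intro mult_left_mono falling_nonneg)
    then show ?thesis
      unfolding falling_Suc_Suc[of r j] falling_Suc[of r j] by (simp add: algebra_simps)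
  qed
  \<comment> \<open>Absorption gives the second sum the binomial coefficients of the first, shifted
    by one, so that both merge term by term.\<close>
  have absorb: "real (Suc t) * real (t choose j) = real (Suc j) * real (Suc t choose Suc j)" for j
    using Suc_times_binomial_eq[of t j] by (metis mult.commute of_nat_mult)
  have "clique_bound r s d + real s * b * clique_bound r (s - 1) d
     = 1 + (\<Sum>j\<le>t. real (Suc t choose Suc j) * (falling r (Suc j) * a ^ Suc j))
         + (\<Sum>j\<le>t. b * (real (Suc t) * real (t choose j)) * (falling r j * a ^ j))"
    unfolding clique_bound_def Suc a_def[symmetric]
    by (subst sum.atMost_Suc_shift) (simp add: sum_distrib_left mult.assoc mult.left_commute)
  also have "\<dots> = 1 + (\<Sum>j\<le>t. real (Suc t choose Suc j) *
      (falling r (Suc j) * a ^ Suc j + real (Suc j) * b * (falling r j * a ^ j)))"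
    unfolding absorb by (simp add: sum.distrib[symmetric] algebra_simps del: binomial_Suc_Suc)
  also have "\<dots> \<le> 1 + (\<Sum>j\<le>t. real (Suc t choose Suc j) *
      (falling (Suc r) (Suc j) * y ^ Suc j))"
    by (intro add_left_mono sum_mono mult_left_mono key) auto
  also have "\<dots> = clique_bound (Suc r) s (d + b)"
    unfolding clique_bound_def Suc y_def[symmetric]
    by (subst sum.atMost_Suc_shift) simp
  finally show ?thesis .
qed

section \<open>Comparison with the binomial expansion\<close>

text \<open>The base case is 240 <= 256. From \<open>r\<close> to \<open>r + 1\<close> the left side
  grows by the factor \<open>r + 2\<close>, the right side by at least \<open>2 * (r + 1)\<close>,
  since \<open>(1 + 1 / r) ^ r\<close> is at least 2 by Bernoulli.\<close>

lemma two_fact_le_power: "4 \<le> r \<Longrightarrow> 2 * fact (Suc r) \<le> real r ^ r"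
proof (induction r rule: dec_induct)
  case base
  then show ?case by (simp add: fact_numeral eval_nat_numeral)
next
  case (step r)
  have "1 + real r * (1 / real r) \<le> (1 + 1 / real r) ^ r"
    by (intro Bernoulli_inequality) (auto intro: order_trans[of _ 0])
  then have "2 * real r ^ r \<le> (1 + 1 / real r) ^ r * real r ^ r"
    using step by (intro mult_right_mono) auto
  also have "\<dots> = real (Suc r) ^ r"
    using step by (simp add: power_mult_distrib[symmetric] field_simps)
  finally have "2 * real r ^ r \<le> real (Suc r) ^ r" .
  then have le: "real (Suc r) * (2 * real r ^ r) \<le> real (Suc r) * real (Suc r) ^ r"
    by (intro mult_left_mono) auto
  have "2 * fact (Suc (Suc r)) = real (Suc (Suc r)) * (2 * fact (Suc r))"
    by (simp only: fact_Suc[of "Suc r"] mult.left_commute)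
  also have "\<dots> \<le> (2 * real (Suc r)) * real r ^ r"
    using step by (intro mult_mono) auto
  also have "\<dots> \<le> real (Suc r) ^ Suc r"
    using le by (simp only: power_Suc mult.assoc mult.left_commute)
  finally show ?case .
qed

text \<open>Both sides are polynomials in \<open>x = real m\<close>, the right one by the binomial
  theorem. The term of degree \<open>r + 1\<close> vanishes, and the terms of degree 3 to
  \<open>r - 1\<close> are dominated one by one. Degrees 1 and 2 are too large on the left, but the
  leading coefficient there is at most 1/2, and the half of \<open>x ^ r\<close> thus saved pays for
  them.\<close>

lemma clique_bound_Suc_le:
  assumes r: "4 \<le> r" "r \<le> m" and m: "5 \<le> m"
  shows "clique_bound r (Suc r) (real m) \<le> (real m + 1) ^ r"
proof -
  define x where "x = real m"
  define c where "c j = falling r j / real r ^ j" for j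
  have x: "5 \<le> x" "real r \<le> x" using assms by (auto simp: x_def)
  have r0: "0 < real r" using r by simp
  have c1: "c 1 = 1" "c 2 = 1 - 1 / real r" "c 0 = 1"
    using r0 by (auto simp: c_def falling_def lessThan_nat_numeral eval_nat_numeral field_simps)
  have binom: "real (Suc r choose j) * (real r + 1 - real j) = (real r + 1) * real (r choose j)"
    if "j \<le> r" for j
  proof -
    have "(Suc r - j) * (Suc r choose j) = Suc r * (r choose j)"
      using binomial_absorb_comp[of "Suc r" j] that by simp
    then have "real (Suc r - j) * real (Suc r choose j) = real (Suc r) * real (r choose j)"
      by (metis of_nat_mult)
    then show ?thesis using that by (simp add: of_nat_diff algebra_simps del: binomial_Suc_Suc)
  qed
  \<comment> \<open>Only the factors \<open>i = 1\<close> and \<open>i = j - 1\<close> of the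
    product are kept, the others being at most 1. These two are distinct because \<open>j\<close> is
    at least 3.\<close>
  have cj: "c j \<le> (real r + 1 - real j) / (real r + 1)" if j: "3 \<le> j" "j \<le> r" for j
  proof -
    have "c j = (\<Prod>i<j. 1 - real i / real r)"
    proof -
      have "c j = (\<Prod>i<j. (real r - real i) / real r)"
        by (simp add: c_def falling_def prod_dividef)
      then show ?thesis using r0 by (simp add: diff_divide_distrib)
    qed
    also have "{..<j} = {1, j - 1} \<union> ({..<j} - {1, j - 1})" using j by auto
    also have "(\<Prod>i\<in>\<dots>. 1 - real i / real r)
      = (\<Prod>i\<in>{1, j - 1}. 1 - real i / real r) * (\<Prod>i\<in>{..<j} - {1, j - 1}. 1 - real i / real r)"
      by (intro prod.union_disjoint) auto
    also have "\<dots> \<le> (\<Prod>i\<in>{1, j - 1}. 1 - real i / real r) * 1"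
      using j r0 by (intro mult_left_mono prod_le_1 prod_nonneg) auto
    also have "\<dots> = (real r - 1) * (real r + 1 - real j) / real r ^ 2"
      using j r0 by (simp add: of_nat_diff field_simps power2_eq_square)
    also have "\<dots> \<le> (real r + 1 - real j) / (real r + 1)"
    proof -
      have "(real r - 1) / real r ^ 2 \<le> 1 / (real r + 1)"
        using r0 by (simp add: field_simps power2_eq_square)
      then have "(real r - 1) / real r ^ 2 * (real r + 1 - real j) \<le> 1 / (real r + 1) * (real r + 1 - real j)"
        using j by (intro mult_right_mono) auto
      then show ?thesis by simp
    qed
    finally show ?thesis .
  qed
  have termwise: "real (Suc r choose j) * c j \<le> real (r choose j)" if j: "3 \<le> j" "j \<le> r" for j
  proof -
    have "real (Suc r choose j) * c j \<le> real (Suc r choose j) * ((real r + 1 - real j) / (real r + 1))"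
      by (intro mult_left_mono cj j) auto
    also have "\<dots> = real (r choose j)"
      using binom[of j] j r0 by (simp add: field_simps del: binomial_Suc_Suc)
    finally show ?thesis .
  qed
  have top: "real (Suc r choose r) * c r \<le> 1 / 2"
  proof -
    have "real (Suc r choose r) * c r = fact (Suc r) / real r ^ r"
      by (simp add: c_def falling_self)
    also have "\<dots> \<le> 1 / 2"
      using two_fact_le_power[OF r(1)] r0 by (simp add: field_simps)
    finally show ?thesis .
  qed
  have split: "(\<Sum>j\<le>r. f j) = f 0 + f 1 + f 2 + (\<Sum>j\<in>{3..<r}. f j) + f r" for f :: "nat \<Rightarrow> real"
  proof -
    have "{..r} = {0, 1, 2} \<union> {3..<r} \<union> {r}" using r by auto
    then show ?thesis using r by (subst \<open>{..r} = _\<close>) (subst sum.union_disjoint, auto)+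
  qed
  have "clique_bound r (Suc r) x = (\<Sum>j\<le>r. real (Suc r choose j) * c j * x ^ j)"
    by (simp add: clique_bound_def falling_eq_0 c_def power_divide field_simps del: binomial_Suc_Suc)
  also have "\<dots> = 1 + (real r + 1) * x + (real r + 1) * real r / 2 * (1 - 1 / real r) * x ^ 2
     + (\<Sum>j\<in>{3..<r}. real (Suc r choose j) * c j * x ^ j) + real (Suc r choose r) * c r * x ^ r"
    unfolding split c1 real_choose_two by (simp add: c1[simplified] algebra_simps)
  also have "\<dots> \<le> 1 + (real r + 1) * x + (real r + 1) * real r / 2 * (1 - 1 / real r) * x ^ 2
     + (\<Sum>j\<in>{3..<r}. real (r choose j) * x ^ j) + 1 / 2 * x ^ r"
    using x by (intro add_mono order_refl sum_mono mult_right_mono termwise top) auto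
  also have "\<dots> \<le> 1 + real r * x + real r * (real r - 1) / 2 * x ^ 2
     + (\<Sum>j\<in>{3..<r}. real (r choose j) * x ^ j) + x ^ r"
  proof -
    \<comment> \<open>This is the excess in degrees 1 and 2, to be covered by the spare half of the
      leading term.\<close>
    have "x + (real r - 1) / 2 * x ^ 2 \<le> 1 / 2 * x ^ r"
    proof -
      have "2 * x + (real r - 1) * x ^ 2 \<le> x ^ 4"
      proof -
        have "2 * x \<le> x ^ 2" using x by (simp add: power2_eq_square)
        then have "2 * x + (real r - 1) * x ^ 2 \<le> real r * x ^ 2" by (simp add: algebra_simps)
        also have "\<dots> \<le> x * x ^ 2" using x by (intro mult_right_mono) auto
        also have "\<dots> \<le> x ^ 4"  using x by (simp add: eval_nat_numeral)
        finally show ?thesis .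
      qed
      also have "\<dots> \<le> x ^ r" using x r by (intro power_increasing) auto
      finally show ?thesis by (simp add: field_simps)
    qed
    moreover have "(real r + 1) * real r / 2 * (1 - 1 / real r) * x ^ 2 =
      real r * (real r - 1) / 2 * x ^ 2 + (real r - 1) / 2 * x ^ 2"
      using r0 by (simp add: field_simps)
    moreover have "(real r + 1) * x = real r * x + x"
      by (simp add: algebra_simps)
    ultimately show ?thesis by linarith
  qed
  also have "\<dots> = (\<Sum>j\<le>r. real (r choose j) * x ^ j)"
    unfolding split by (simp add: real_choose_two)
  also have "\<dots> = (x + 1) ^ r"
    by (simp add: binomial_ring[of x 1])
  finally show ?thesis by (simp add: x_def)
qed

section \<open>Counting homomorphisms into a graph with a looped universal vertex\<close>

locale collision_graph =
  fixes R :: "'v \<Rightarrow> 'v \<Rightarrow> bool" and e :: 'v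
  assumes sym: "R x y \<Longrightarrow> R y x" and irrefl: "\<not> R x x"
begin

section \<open>Homomorphisms and cliques\<close>

text \<open>The alternatives with \<open>e\<close> make \<open>e\<close> adjacent to every vertex
  including itself. Functions are fixed outside \<open>D\<close>, so that the set is finite and can
  be counted.\<close>

definition homs :: "'v set \<Rightarrow> ('v \<Rightarrow> 'v \<Rightarrow> bool) \<Rightarrow> 'v set \<Rightarrow> ('v \<Rightarrow> 'v) set" where
  "homs D S X = {f \<in> D \<rightarrow>\<^sub>E insert e X.
     \<forall>i\<in>D. \<forall>j\<in>D. S i j \<longrightarrow> f i = e \<or> f j = e \<or> R (f i) (f j)}"

abbreviation clique_homs :: "'v set \<Rightarrow> 'v set \<Rightarrow> ('v \<Rightarrow> 'v) set" where
  "clique_homs D X \<equiv> homs D (\<noteq>) X"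

definition nbs :: "'v set \<Rightarrow> 'v \<Rightarrow> 'v set" where
  "nbs X p = {x \<in> X. R p x}"

definition clique :: "'v set \<Rightarrow> bool" where
  "clique Y \<longleftrightarrow> (\<forall>x\<in>Y. \<forall>y\<in>Y. x \<noteq> y \<longrightarrow> R x y)"

definition clique_number_le :: "'v set \<Rightarrow> nat \<Rightarrow> bool" where
  "clique_number_le X r \<longleftrightarrow> (\<forall>Y\<subseteq>X. clique Y \<longrightarrow> card Y \<le> r)"

lemma finite_homs [simp]: "finite D \<Longrightarrow> finite X \<Longrightarrow> finite (homs D S X)"
  by (rule finite_subset[of _ "D \<rightarrow>\<^sub>E insert e X"]) (auto simp: homs_def intro: finite_PiE)

lemma nbs_subset: "nbs X p \<subseteq> X"
  by (auto simp: nbs_def)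

lemma finite_nbs [simp]: "finite X \<Longrightarrow> finite (nbs X p)"
  by (simp add: nbs_def)

lemma card_nbs_less: "finite X \<Longrightarrow> p \<in> X \<Longrightarrow> card (nbs X p) < card X"
  using irrefl by (intro psubset_card_mono) (auto simp: nbs_def)

lemma card_PiE_insert_le:
  assumes "finite D" "finite X"
  shows "card (D \<rightarrow>\<^sub>E insert e X) \<le> (card X + 1) ^ card D"
  using assms by (simp add: card_PiE card_insert_if power_mono)

lemma card_homs_le: "finite D \<Longrightarrow> finite X \<Longrightarrow> card (homs D S X) \<le> (card X + 1) ^ card D"
  by (rule order_trans[OF card_mono card_PiE_insert_le]) (auto simp: homs_def intro: finite_PiE)

text \<open>Only the edges inside \<open>W\<close> are kept as constraints; every vertex of
  \<open>D - W\<close> chooses its value freely.\<close>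

lemma card_homs_le_clique:
  assumes fin: "finite D" "finite X" and W: "W \<subseteq> D"
    and S: "\<And>i j. i \<in> W \<Longrightarrow> j \<in> W \<Longrightarrow> i \<noteq> j \<Longrightarrow> S i j"
  shows "card (homs D S X) \<le> card (clique_homs W X) * (card X + 1) ^ (card D - card W)"
proof -
  let ?h = "\<lambda>f. (restrict f W, restrict f (D - W))"
  have finW: "finite W" using fin W finite_subset by blast
  have "inj_on ?h (homs D S X)"
  proof (rule inj_onI)
    fix f g assume f: "f \<in> homs D S X" and g: "g \<in> homs D S X" and eq: "?h f = ?h g"
    show "f = g"
    proof
      fix x
      show "f x = g x"
        using f g fun_cong[OF conjunct1[OF eq[unfolded prod.inject]], of x]
          fun_cong[OF conjunct2[OF eq[unfolded prod.inject]], of x]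
        by (cases "x \<in> D"; cases "x \<in> W") (auto simp: homs_def PiE_def extensional_def)
    qed
  qed
  moreover have "?h ` homs D S X \<subseteq> clique_homs W X \<times> ((D - W) \<rightarrow>\<^sub>E insert e X)"
  proof (rule image_subsetI)
    fix f assume f: "f \<in> homs D S X"
    have *: "i \<in> D" if "i \<in> W" for i using that W by blast
    have "restrict f W \<in> clique_homs W X"
      using f S * by (simp add: homs_def PiE_iff)
    moreover have "restrict f (D - W) \<in> (D - W) \<rightarrow>\<^sub>E insert e X"
      using f by (simp add: homs_def PiE_iff)
    ultimately show "?h f \<in> clique_homs W X \<times> ((D - W) \<rightarrow>\<^sub>E insert e X)" by simp
  qed
  ultimately have "card (homs D S X) \<le> card (clique_homs W X \<times> ((D - W) \<rightarrow>\<^sub>E insert e X))"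
    using fin finW
    by (intro card_inj_on_le[of ?h] finite_cartesian_product finite_homs finite_PiE) auto
  also have "\<dots> \<le> card (clique_homs W X) * (card X + 1) ^ card (D - W)"
    unfolding card_cartesian_product using fin by (intro mult_left_mono card_PiE_insert_le) auto
  finally show ?thesis using W finW by (simp add: card_Diff_subset)
qed

lemma clique_homs_insert_iff:
  assumes "z \<notin> D"
  shows "f \<in> clique_homs (insert z D) X \<longleftrightarrow>
    f \<in> insert z D \<rightarrow>\<^sub>E insert e X \<and>
    restrict f D \<in> clique_homs D (if f z = e then X else nbs X (f z))"
proof (cases "f z = e")
  case True
  then show ?thesis using assms by (auto simp: homs_def PiE_iff extensional_def)
next
  case False
  have "(\<forall>j\<in>D. f j = e \<or> R (f z) (f j)) \<longleftrightarrow> (\<forall>j\<in>D. f j = e \<or> R (f j) (f z))"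
    using sym by blast
  with False assms show ?thesis
    by (auto simp: homs_def nbs_def PiE_iff extensional_def)
qed

text \<open>The maps are sorted by the image of \<open>z\<close>. If it is \<open>e\<close>, the
  other vertices are unrestricted; if it is \<open>p\<close>, they must go to \<open>e\<close> or to
  neighbours of \<open>p\<close>.\<close>

lemma card_clique_homs_insert:
  assumes "z \<notin> D" and fin: "finite D" "finite X" and "e \<notin> X"
  shows "card (clique_homs (insert z D) X)
    = card (clique_homs D X) + (\<Sum>p\<in>X. card (clique_homs D (nbs X p)))"
proof -
  let ?N = "\<lambda>p. if p = e then X else nbs X p"
  let ?h = "\<lambda>f. (f z, restrict f D)"
  have "bij_betw ?h (clique_homs (insert z D) X)
      (SIGMA p:insert e X. clique_homs D (?N p))"
  proof (rule bij_betw_byWitness[where f' = "\<lambda>(p, f). f(z := p)"])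
    show "\<forall>f\<in>clique_homs (insert z D) X. (\<lambda>(p, f). f(z := p)) (?h f) = f"
    proof
      fix f assume "f \<in> clique_homs (insert z D) X"
      then have "f \<in> extensional (insert z D)" by (auto simp: homs_def PiE_def)
      then show "(\<lambda>(p, f). f(z := p)) (?h f) = f"
        by (auto simp: fun_eq_iff extensional_def)
    qed
    have res: "restrict (f(z := p)) D = f" if "f \<in> clique_homs D Y" for f p Y
    proof -
      have "f \<in> extensional D" using that by (auto simp: homs_def PiE_def)
      then show ?thesis using assms(1) by (auto simp: fun_eq_iff extensional_def restrict_def)
    qed
    show "\<forall>x\<in>(SIGMA p:insert e X. clique_homs D (?N p)). ?h ((\<lambda>(p, f). f(z := p)) x) = x"
      using res by (auto split: if_splits)
    show "?h ` clique_homs (insert z D) X \<subseteq> (SIGMA p:insert e X. clique_homs D (?N p))"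
    proof (rule image_subsetI)
      fix f assume "f \<in> clique_homs (insert z D) X"
      then have "f \<in> insert z D \<rightarrow>\<^sub>E insert e X" "restrict f D \<in> clique_homs D (?N (f z))"
        unfolding clique_homs_insert_iff[OF assms(1)] by blast+
      then show "?h f \<in> (SIGMA p:insert e X. clique_homs D (?N p))"
        unfolding mem_Sigma_iff by (meson PiE_mem insertI1)
    qed
    show "(\<lambda>(p, f). f(z := p)) ` (SIGMA p:insert e X. clique_homs D (?N p))
        \<subseteq> clique_homs (insert z D) X"
    proof (clarify)
      fix p f assume p: "p \<in> insert e X" and f: "f \<in> clique_homs D (?N p)"
      have "f \<in> D \<rightarrow>\<^sub>E insert e (?N p)" using f by (simp add: homs_def)
      then have "f(z := p) \<in> insert z D \<rightarrow>\<^sub>E insert e X"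
        using p nbs_subset[of X p] by (auto simp: PiE_iff extensional_def split: if_splits)
      then show "f(z := p) \<in> clique_homs (insert z D) X"
        unfolding clique_homs_insert_iff[OF assms(1)] using f res[OF f]
          by (cases "p = e") simp_all
    qed
  qed
  then have "card (clique_homs (insert z D) X)
      = card (SIGMA p:insert e X. clique_homs D (?N p))"
    by (rule bij_betw_same_card)
  also have "\<dots> = (\<Sum>p\<in>insert e X. card (clique_homs D (?N p)))"
    using fin by (intro card_SigmaI) auto
  also have "\<dots> = card (clique_homs D X) + (\<Sum>p\<in>X. card (clique_homs D (?N p)))"
    using fin assms(4) by simp
  also have "(\<Sum>p\<in>X. card (clique_homs D (?N p))) = (\<Sum>p\<in>X. card (clique_homs D (nbs X p)))"
    using assms(4) by (intro sum.cong) auto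
  finally show ?thesis .
qed

lemma clique_number_le_nbs:
  assumes "finite X" "p \<in> X" "clique_number_le X (Suc r)"
  shows "clique_number_le (nbs X p) r"
  unfolding clique_number_le_def
proof (intro allI impI)
  fix Y assume Y: "Y \<subseteq> nbs X p" "clique Y"
  have "clique (insert p Y)"
    using Y sym by (auto simp: clique_def nbs_def)
  moreover have "insert p Y \<subseteq> X" using Y assms nbs_subset by auto
  ultimately have "card (insert p Y) \<le> Suc r"
    using assms(3) by (simp add: clique_number_le_def)
  moreover have "p \<notin> Y" using Y irrefl by (auto simp: nbs_def)
  moreover have "finite Y" using Y assms(1) nbs_subset finite_subset by metis
  ultimately show "card Y \<le> r" by simp
qed

lemma card_clique_homs_through_le:
  assumes fin: "finite D" "finite X" and "i \<in> D" "x \<noteq> e"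
  shows "card {f \<in> clique_homs D X. f i = x} \<le> card (clique_homs (D - {i}) (nbs X x))"
proof (rule card_inj_on_le[where f = "\<lambda>f. restrict f (D - {i})"])
  show "inj_on (\<lambda>f. restrict f (D - {i})) {f \<in> clique_homs D X. f i = x}"
  proof (rule inj_onI)
    fix f g assume f: "f \<in> {f \<in> clique_homs D X. f i = x}"
      and g: "g \<in> {f \<in> clique_homs D X. f i = x}"
      and eq: "restrict f (D - {i}) = restrict g (D - {i})"
    show "f = g"
    proof
      fix y
      show "f y = g y" using f g fun_cong[OF eq, of y]
        by (cases "y = i"; cases "y \<in> D") (auto simp: homs_def PiE_def extensional_def)
    qed
  qed
  have D: "D = insert i (D - {i})" using assms(3) by auto
  show "(\<lambda>f. restrict f (D - {i})) ` {f \<in> clique_homs D X. f i = x}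
      \<subseteq> clique_homs (D - {i}) (nbs X x)"
    using assms(4) by (subst D, subst clique_homs_insert_iff) auto
qed (use fin in auto)

text \<open>Induction on the clique number, as in the degree proof of Turan's theorem. Let
  \<open>p\<close> have largest degree \<open>d\<close>. A map either has its values among
  \<open>e\<close> and the neighbours of \<open>p\<close>, or takes some value \<open>x\<close>
  outside this neighbourhood at some vertex \<open>i\<close>, and then the rest maps into the
  neighbourhood of \<open>x\<close>, which has at most \<open>d\<close> vertices. Both
  neighbourhoods have smaller clique number, and \<open>clique_bound_step\<close> combines the two
  counts; maps counted repeatedly do no harm.\<close>

lemma card_clique_homs_le_clique_bound:
  assumes "finite X" "clique_number_le X r" "finite D" "e \<notin> X"
  shows "real (card (clique_homs D X)) \<le> clique_bound r (card D) (real (card X))"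
  using assms
proof (induction r arbitrary: X D)
  case 0
  have "X = {}"
  proof (rule ccontr)
    assume "X \<noteq> {}"
    then obtain x where "x \<in> X" by auto
    moreover have "clique {x}" by (simp add: clique_def)
    ultimately have "card {x} \<le> 0"
      using 0 unfolding clique_number_le_def by blast
    then show False by simp
  qed
  then show ?case using card_homs_le[of D X "(\<noteq>)"] 0 by simp
next
  case (Suc r)
  show ?case
  proof (cases "X = {}")
    case True
    then show ?thesis using card_homs_le[of D X "(\<noteq>)"] Suc by simp
  next
    case False
    obtain p where p: "p \<in> X" and pmax: "\<And>x. x \<in> X \<Longrightarrow> card (nbs X x) \<le> card (nbs X p)"
      using Max_in[of "(\<lambda>x. card (nbs X x)) ` X"] Max_ge[of "(\<lambda>x. card (nbs X x)) ` X"]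
        False Suc.prems(1) by (smt (verit) finite_imageI image_iff image_is_empty)
    let ?s = "card D" and ?d = "card (nbs X p)"
    let ?Z = "X - nbs X p"
    have cn: "clique_number_le (nbs X x) r" if "x \<in> X" for x
      using clique_number_le_nbs[OF Suc.prems(1) that Suc.prems(2)] .
    have e: "e \<notin> nbs X x" for x using Suc.prems(4) nbs_subset by auto
    have sub: "clique_homs D X \<subseteq> clique_homs D (nbs X p) \<union>
        (\<Union>i\<in>D. \<Union>x\<in>?Z. {f \<in> clique_homs D X. f i = x})"
      by (fastforce simp: homs_def)
    have "card (clique_homs D X) \<le> card (clique_homs D (nbs X p)) +
        card (\<Union>i\<in>D. \<Union>x\<in>?Z. {f \<in> clique_homs D X. f i = x})"
      using Suc.prems by (intro order_trans[OF card_mono[OF _ sub] card_Un_le]) auto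
    also have "card (\<Union>i\<in>D. \<Union>x\<in>?Z. {f \<in> clique_homs D X. f i = x})
        \<le> (\<Sum>i\<in>D. \<Sum>x\<in>?Z. card {f \<in> clique_homs D X. f i = x})"
      using Suc.prems by (intro order_trans[OF card_UN_le] sum_mono card_UN_le) auto
    finally have "real (card (clique_homs D X)) \<le> real (card (clique_homs D (nbs X p))) +
        (\<Sum>i\<in>D. \<Sum>x\<in>?Z. real (card {f \<in> clique_homs D X. f i = x}))"
      by (simp only: of_nat_sum[symmetric] of_nat_add[symmetric] of_nat_le_iff)
    also have "\<dots> \<le> clique_bound r ?s ?d + (\<Sum>i\<in>D. \<Sum>x\<in>?Z. clique_bound r (?s - 1) ?d)"
    proof (intro add_mono sum_mono)
      show "real (card (clique_homs D (nbs X p))) \<le> clique_bound r ?s ?d"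
        using Suc.IH[OF _ cn[OF p] Suc.prems(3) e] Suc.prems(1) by simp
      fix i x assume i: "i \<in> D" and x: "x \<in> ?Z"
      have "real (card {f \<in> clique_homs D X. f i = x}) \<le> real (card (clique_homs (D - {i}) (nbs X x)))"
        using x i Suc.prems by (intro of_nat_mono card_clique_homs_through_le) auto
      also have "\<dots> \<le> clique_bound r (?s - 1) (card (nbs X x))"
        using Suc.IH[OF _ cn _ e, of x "D - {i}"] Suc.prems i x by simp
      also have "\<dots> \<le> clique_bound r (?s - 1) ?d"
        using pmax x by (intro clique_bound_mono) auto
      finally show "real (card {f \<in> clique_homs D X. f i = x}) \<le> clique_bound r (?s - 1) ?d" .
    qed
    also have "\<dots> = clique_bound r ?s ?d + real ?s * real (card ?Z) * clique_bound r (?s - 1) ?d"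
      by simp
    also have "\<dots> \<le> clique_bound (Suc r) ?s (real ?d + real (card ?Z))"
    proof (rule clique_bound_step)
      show "r = 0 \<longrightarrow> real ?d = 0"
      proof
        assume "r = 0"
        then have "clique_number_le (nbs X p) 0" using cn[OF p] by simp
        then have "x \<notin> nbs X p" for x
          unfolding clique_number_le_def
          by (auto simp: clique_def dest!: spec[of _ "{x}"])
        then show "real ?d = 0" by (metis card.empty equals0I of_nat_0)
      qed
    qed auto
    also have "real ?d + real (card ?Z) = real (card X)"
      using Suc.prems(1) nbs_subset[of X p] card_mono[OF Suc.prems(1) nbs_subset[of X p]]
      by (simp add: card_Diff_subset finite_subset)
    finally show ?thesis .
  qed
qed

section \<open>Small domains and degree sums\<close>

lemma card_clique_homs_empty: "card (clique_homs {} X) = 1"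
proof -
  have "clique_homs {} X = {\<lambda>_. undefined}" by (auto simp: homs_def)
  then show ?thesis by simp
qed

lemma card_clique_homs_pair:
  assumes "finite X" "e \<notin> X" "v \<noteq> w"
  shows "card (clique_homs {v, w} X) = 1 + 2 * card X + (\<Sum>p\<in>X. card (nbs X p))"
proof -
  have one: "card (clique_homs {w} Y) = card Y + 1" if "Y \<subseteq> X" for Y
    using card_clique_homs_insert[of w "{}" Y] that assms finite_subset[OF that]
    by (auto simp: card_clique_homs_empty)
  have "card (clique_homs {v, w} X) = (card X + 1) + (\<Sum>p\<in>X. card (nbs X p) + 1)"
    using card_clique_homs_insert[of v "{w}" X] assms by (simp add: one nbs_subset)
  then show ?thesis by (simp add: sum_Suc)
qed

text \<open>Turan's bound on the number of edges, read off from the clique bound for a domain of two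
  vertices; \<open>v\<close> and \<open>w\<close> only supply such a domain.\<close>

lemma sum_degrees_le:
  assumes "finite X" "e \<notin> X" "clique_number_le X r" "v \<noteq> (w :: 'v)"
  shows "1 + 2 * real (card X) + (\<Sum>p\<in>X. real (card (nbs X p))) \<le> clique_bound r 2 (real (card X))"
proof -
  have "card {v, w} = 2" using assms(4) by simp
  then have "real (card (clique_homs {v, w} X)) \<le> clique_bound r 2 (real (card X))"
    using card_clique_homs_le_clique_bound[OF assms(1,3) _ assms(2), of "{v, w}"] by simp
  then show ?thesis using card_clique_homs_pair[OF assms(1,2,4)] by simp
qed

lemma falling_small:
  "falling 1 1 = 1" "falling 1 2 = 0" "falling 2 1 = 2" "falling 2 2 = 2" "falling 2 3 = 0"
  "falling 3 1 = 3" "falling 3 2 = 6" "falling 3 3 = 6"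
  by (simp_all add: falling_def lessThan_nat_numeral)

lemma clique_bound_small:
  "clique_bound 1 2 x = 1 + 2 * x"
  "clique_bound 2 2 x = 1 + 2 * x + x\<^sup>2 / 2"
  "clique_bound 2 3 x = 1 + 3 * x + 3 / 2 * x\<^sup>2"
  "clique_bound 3 2 x = 1 + 2 * x + 2 / 3 * x\<^sup>2"
  "clique_bound 3 3 x = 1 + 3 * x + 2 * x\<^sup>2 + 2 / 9 * x ^ 3"
  using falling_small
  by (simp_all add: clique_bound_def atMost_nat_numeral power_divide binomial_eq_0 eval_nat_numeral)

section \<open>The total count for a graph with an edge\<close>

text \<open>The left side counts homomorphisms of the cone over the graph, sorted by the image of
  the apex: \<open>e\<close> in the first term, a vertex \<open>p\<close> in the sum. A largest
  clique \<open>W\<close> of size \<open>r\<close> carries the essential constraints, and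
  \<open>K\<close> bounds the free choices outside \<open>W\<close>.\<close>

lemma card_homs_total_le:
  assumes fin: "finite V" and e: "e \<notin> V" and m: "5 \<le> card V"
    and edge: "p \<in> V" "q \<in> V" "R p q"
  shows "card (homs V R V) + (\<Sum>p\<in>V. card (homs V R (nbs V p))) \<le> (card V + 1) ^ card V"
proof -
  have "finite (card ` {Y. Y \<subseteq> V \<and> clique Y})" using fin by simp
  moreover have "{p, q} \<in> {Y. Y \<subseteq> V \<and> clique Y}"
    using edge sym by (auto simp: clique_def)
  ultimately obtain W where W: "W \<subseteq> V" "clique W" and Wmax: "clique_number_le V (card W)"
    unfolding clique_number_le_def
    using Max_in[of "card ` {Y. Y \<subseteq> V \<and> clique Y}"] Max_ge[of "card ` {Y. Y \<subseteq> V \<and> clique Y}"]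
    by (smt (verit) empty_iff imageE image_eqI image_is_empty mem_Collect_eq)
  define r where "r = card W"
  define y where "y = real (card V)"
  define d where "d p = real (card (nbs V p))" for p
  define K where "K = (y + 1) ^ (card V - r)"
  have cn: "clique_number_le V r" using Wmax by (simp add: r_def)
  have finW: "finite W" using W fin finite_subset by blast
  have eW: "e \<notin> W" using W e by auto
  have pq: "p \<noteq> q" using edge irrefl by auto
  have "card {p, q} \<le> r"
    using cn edge sym unfolding clique_number_le_def by (auto simp: clique_def)
  then have r2: "2 \<le> r" using pq by simp
  have rm: "r \<le> card V" unfolding r_def using W fin by (intro card_mono) auto
  have y: "5 \<le> y" using m by (simp add: y_def)
  have K: "0 < K" "(y + 1) ^ r * K = (y + 1) ^ card V"
    using y rm by (auto simp: K_def power_add[symmetric])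
  have d: "0 \<le> d p" "p \<in> V \<Longrightarrow> d p \<le> y - 1" for p
    using card_nbs_less[OF fin, of p] by (auto simp: d_def y_def)
  have eN: "e \<notin> nbs V p" for p using e nbs_subset by auto
  have hV: "real (card (homs V R V)) \<le> real (card (clique_homs W V)) * K"
    using card_homs_le_clique[OF fin fin W(1), of R] W(2)
    unfolding clique_def K_def y_def r_def
    by (metis (no_types, lifting) of_nat_1 of_nat_add of_nat_le_iff of_nat_mult of_nat_power)
  have hp: "real (card (homs V R (nbs V p)))
      \<le> real (card (clique_homs W (nbs V p))) * (d p + 1) ^ (card V - r)" for p
    using card_homs_le_clique[OF fin finite_nbs[OF fin] W(1), of R] W(2)
    unfolding clique_def d_def r_def
    by (metis (no_types, lifting) of_nat_1 of_nat_add of_nat_le_iff of_nat_mult of_nat_power)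
  have hp': "real (card (homs V R (nbs V p)))
      \<le> clique_bound s r (d p) * L"
    if "p \<in> V" "r = Suc s" "(d p + 1) ^ (card V - r) \<le> L" for p s L
  proof -
    have "clique_number_le (nbs V p) s"
      using clique_number_le_nbs[OF fin that(1)] cn that(2) by simp
    then have "real (card (clique_homs W (nbs V p))) \<le> clique_bound s r (d p)"
      using card_clique_homs_le_clique_bound[OF finite_nbs[OF fin] _ finW eN] by (simp add: r_def d_def)
    then have "real (card (clique_homs W (nbs V p))) * (d p + 1) ^ (card V - r)
        \<le> clique_bound s r (d p) * L"
      using that(3) d(1)[of p] by (intro mult_mono) (auto intro: order_trans[of _ "real (card (clique_homs W (nbs V p)))"])
    then show ?thesis using hp[of p] by linarith
  qed
  have "real (card (homs V R V)) + (\<Sum>p\<in>V. real (card (homs V R (nbs V p)))) \<le> (y + 1) ^ r * K"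
  proof -
    consider "4 \<le> r" | "r = 3" | "r = 2" "\<forall>p\<in>V. d p \<le> y - 2"
      | c where "r = 2" "c \<in> V" "y - 2 < d c"
    proof -
      assume *: "4 \<le> r \<Longrightarrow> thesis" "r = 3 \<Longrightarrow> thesis"
        "r = 2 \<Longrightarrow> \<forall>p\<in>V. d p \<le> y - 2 \<Longrightarrow> thesis"
        "\<And>c. r = 2 \<Longrightarrow> c \<in> V \<Longrightarrow> y - 2 < d c \<Longrightarrow> thesis"
      have "4 \<le> r \<or> r = 3 \<or> r = 2" using r2 by linarith
      then show thesis using * linorder_not_less by blast
    qed
    then show ?thesis
    proof cases
      case 1
      have "real (card (homs V R (nbs V p))) \<le> real (card (clique_homs W (nbs V p))) * K"
        if "p \<in> V" for p
        using hp[of p] mult_left_mono[of "(d p + 1) ^ (card V - r)" K "real (card (clique_homs W (nbs V p)))"]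
          d[of p] that y unfolding K_def by (smt (verit) of_nat_0_le_iff power_mono)
      then have "real (card (homs V R V)) + (\<Sum>p\<in>V. real (card (homs V R (nbs V p))))
          \<le> real (card (clique_homs W V)) * K + (\<Sum>p\<in>V. real (card (clique_homs W (nbs V p))) * K)"
        by (intro add_mono sum_mono hV)
      \<comment> \<open>Here \<open>e\<close> serves as a fresh domain vertex, namely the apex,
        which together with \<open>W\<close> forms a clique of size \<open>r + 1\<close>.\<close>
      also have "\<dots> = real (card (clique_homs (insert e W) V)) * K"
        using card_clique_homs_insert[OF eW finW fin e]
        by (simp add: sum_distrib_right distrib_right)
      also have "\<dots> \<le> (y + 1) ^ r * K"
      proof (rule mult_right_mono)
        have "real (card (clique_homs (insert e W) V)) \<le> clique_bound r (Suc r) y"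
          using card_clique_homs_le_clique_bound[OF fin cn _ e, of "insert e W"] finW eW
          by (simp add: r_def y_def)
        also have "\<dots> \<le> (y + 1) ^ r"
          unfolding y_def by (rule clique_bound_Suc_le[OF 1 rm m])
        finally show "real (card (clique_homs (insert e W) V)) \<le> (y + 1) ^ r" .
      qed (use K in simp)
      finally show ?thesis .
    next
      case 2
      \<comment> \<open>Since \<open>d p + 1\<close> is at most \<open>y\<close>, the free choices
        drop from \<open>K\<close> to \<open>L\<close>. Bernoulli gives the ratio 7/5, exactly what
        \<open>1 + (y - 3) / y\<close> yields at \<open>y = 5\<close>.\<close>
      define L where "L = y ^ (card V - r)"
      have L0: "0 \<le> L" using y by (simp add: L_def)
      have LK: "7 / 5 * L \<le> K"
      proof -
        have "1 + real (card V - r) * (1 / y) \<le> (1 + 1 / y) ^ (card V - r)"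
          by (rule Bernoulli_inequality, rule order_trans[of _ 0]) (use y in auto)
        moreover have "7 / 5 \<le> 1 + real (card V - r) * (1 / y)"
          using y 2 rm by (simp add: of_nat_diff y_def field_simps)
        ultimately have "7 / 5 \<le> (1 + 1 / y) ^ (card V - r)"
          by (rule order_trans[rotated])
        then have "7 / 5 * L \<le> (1 + 1 / y) ^ (card V - r) * L"
          using L0 by (rule mult_right_mono)
        also have "\<dots> = K"
          using y by (simp add: L_def K_def power_mult_distrib[symmetric] field_simps)
        finally show ?thesis .
      qed
      have D: "(\<Sum>p\<in>V. d p) \<le> 2 / 3 * y\<^sup>2"
        using sum_degrees_le[OF fin e cn pq] unfolding 2 clique_bound_small by (simp add: d_def y_def)
      have "real (card (homs V R (nbs V p))) \<le> (1 + 3 / 2 * (y + 1) * d p) * L" if "p \<in> V" for p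
      proof -
        have "real (card (homs V R (nbs V p))) \<le> clique_bound 2 r (d p) * L"
          by (rule hp'[OF that]) (use 2 d[of p] that in \<open>auto simp: L_def intro: power_mono\<close>)
        \<comment> \<open>Making the bound linear in \<open>d p\<close> reduces the sum over
          \<open>p\<close> to the degree sum.\<close>
        moreover have "d p * d p \<le> (y - 1) * d p"
          using d[of p] that by (intro mult_right_mono) auto
        then have "clique_bound 2 r (d p) \<le> 1 + 3 / 2 * (y + 1) * d p"
          unfolding 2 clique_bound_small by (simp add: power2_eq_square algebra_simps)
        ultimately show ?thesis using L0 by (meson mult_right_mono order_trans)
      qed
      then have "(\<Sum>p\<in>V. real (card (homs V R (nbs V p)))) \<le> (\<Sum>p\<in>V. (1 + 3 / 2 * (y + 1) * d p) * L)"
        by (intro sum_mono)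
      also have "\<dots> = (y + 3 / 2 * (y + 1) * (\<Sum>p\<in>V. d p)) * L"
        by (simp add: sum_distrib_left sum_distrib_right[symmetric] sum.distrib y_def)
      also have "\<dots> \<le> (y + 3 / 2 * (y + 1) * (2 / 3 * y\<^sup>2)) * L"
        using D y L0 by (intro mult_right_mono add_left_mono mult_left_mono) auto
      also have "\<dots> \<le> (y + 3 / 2 * (y + 1) * (2 / 3 * y\<^sup>2)) * (5 / 7 * K)"
        using LK y by (intro mult_left_mono) auto
      finally have *: "(\<Sum>p\<in>V. real (card (homs V R (nbs V p))))
          \<le> (y + 3 / 2 * (y + 1) * (2 / 3 * y\<^sup>2)) * (5 / 7 * K)" .
      have "real (card (clique_homs W V)) \<le> clique_bound r r y"
        using card_clique_homs_le_clique_bound[OF fin cn finW e] by (simp add: r_def y_def)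
      then have "real (card (homs V R V)) \<le> clique_bound 3 3 y * K"
        using hV K(1) unfolding 2 by (meson less_imp_le mult_right_mono order_trans)
      with * have "real (card (homs V R V)) + (\<Sum>p\<in>V. real (card (homs V R (nbs V p))))
        \<le> (clique_bound 3 3 y + 5 / 7 * (y + 3 / 2 * (y + 1) * (2 / 3 * y\<^sup>2))) * K"
        by (simp add: algebra_simps)
      also have "\<dots> \<le> (y + 1) ^ 3 * K"
      proof (rule mult_right_mono)
        have "5 * y \<le> y\<^sup>2" "0 \<le> y ^ 3" using y by (auto simp: power2_eq_square)
        moreover have "clique_bound 3 3 y + 5 / 7 * (y + 3 / 2 * (y + 1) * (2 / 3 * y\<^sup>2))
            = (y + 1) ^ 3 + 5 / 7 * y - 2 / 7 * y\<^sup>2 - 4 / 63 * y ^ 3"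
          unfolding clique_bound_small by (simp add: power3_eq_cube power2_eq_square field_simps)
        ultimately show "clique_bound 3 3 y + 5 / 7 * (y + 3 / 2 * (y + 1) * (2 / 3 * y\<^sup>2)) \<le> (y + 1) ^ 3"
          using y by linarith
      qed (use K in simp)
      finally show ?thesis unfolding 2 .
    next
      case 3
      \<comment> \<open>Degrees are at most \<open>y - 2\<close> here, so each free vertex has at
        most \<open>y - 1\<close> choices; the ratio 5/2 is again the Bernoulli value at
        \<open>y = 5\<close>.\<close>
      define L where "L = (y - 1) ^ (card V - r)"
      define D where "D = (\<Sum>p\<in>V. d p)"
      have L0: "0 \<le> L" using y by (simp add: L_def)
      have LK: "5 / 2 * L \<le> K"
      proof -
        have "1 + real (card V - r) * (2 / (y - 1)) \<le> (1 + 2 / (y - 1)) ^ (card V - r)"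
          by (rule Bernoulli_inequality, rule order_trans[of _ 0]) (use y in auto)
        moreover have "5 / 2 \<le> 1 + real (card V - r) * (2 / (y - 1))"
          using y 3 rm by (simp add: of_nat_diff y_def field_simps)
        ultimately have "5 / 2 \<le> (1 + 2 / (y - 1)) ^ (card V - r)"
          by (rule order_trans[rotated])
        then have "5 / 2 * L \<le> (1 + 2 / (y - 1)) ^ (card V - r) * L"
          using L0 by (rule mult_right_mono)
        also have "\<dots> = ((1 + 2 / (y - 1)) * (y - 1)) ^ (card V - r)"
          by (simp add: L_def power_mult_distrib)
        also have "(1 + 2 / (y - 1)) * (y - 1) = y + 1"
          using y by (simp add: field_simps)
        finally show ?thesis by (simp add: K_def)
      qed
      have D: "D \<le> y\<^sup>2 / 2"
        using sum_degrees_le[OF fin e cn pq] unfolding 3 clique_bound_small by (simp add: d_def y_def D_def)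
      have "real (card (homs V R (nbs V p))) \<le> (1 + 2 * d p) * L" if "p \<in> V" for p
      proof -
        have "(d p + 1) ^ (card V - r) \<le> L"
          unfolding L_def using 3 d[of p] that by (intro power_mono) auto
        then show ?thesis
          using hp'[OF that, of 1 L] 3 by (simp add: clique_bound_small[simplified])
      qed
      then have "(\<Sum>p\<in>V. real (card (homs V R (nbs V p)))) \<le> (\<Sum>p\<in>V. (1 + 2 * d p) * L)"
        by (intro sum_mono)
      also have "\<dots> = (y + 2 * D) * L"
        by (simp add: sum_distrib_left sum_distrib_right[symmetric] sum.distrib y_def D_def)
      also have "\<dots> \<le> (y + y\<^sup>2) * (2 / 5 * K)"
        using D y L0 LK by (intro mult_mono) auto
      finally have *: "(\<Sum>p\<in>V. real (card (homs V R (nbs V p)))) \<le> (y + y\<^sup>2) * (2 / 5 * K)" .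
      have "real (card (clique_homs W V)) \<le> clique_bound r r y"
        using card_clique_homs_le_clique_bound[OF fin cn finW e] by (simp add: r_def y_def)
      then have "real (card (homs V R V)) \<le> clique_bound 2 2 y * K"
        using hV K(1) unfolding 3 by (meson less_imp_le mult_right_mono order_trans)
      with * have "real (card (homs V R V)) + (\<Sum>p\<in>V. real (card (homs V R (nbs V p))))
        \<le> (clique_bound 2 2 y + 2 / 5 * (y + y\<^sup>2)) * K"
        by (simp add: field_simps)
      also have "\<dots> \<le> (y + 1) ^ 2 * K"
      proof (rule mult_right_mono)
        have "5 * y \<le> y\<^sup>2" using y by (auto simp: power2_eq_square)
        moreover have "clique_bound 2 2 y + 2 / 5 * (y + y\<^sup>2)
            = (y + 1)\<^sup>2 + 2 / 5 * y - y\<^sup>2 / 10"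
          unfolding clique_bound_small by (simp add: power2_eq_square field_simps)
        ultimately show "clique_bound 2 2 y + 2 / 5 * (y + y\<^sup>2) \<le> (y + 1)\<^sup>2"
          using y by linarith
      qed (use K in simp)
      finally show ?thesis unfolding 3 .
    next
      case 4
      \<comment> \<open>A degree above \<open>y - 2\<close> must be \<open>y - 1\<close>, so
        \<open>c\<close> is adjacent to all other vertices. As there are no triangles, the graph is
        a star with centre \<open>c\<close>.\<close>
      have "card (nbs V c) = card (V - {c})"
        using 4 card_nbs_less[OF fin 4(2)] fin by (auto simp: d_def y_def)
      moreover have "nbs V c \<subseteq> V - {c}" using irrefl by (auto simp: nbs_def)
      ultimately have Nc: "nbs V c = V - {c}" using fin by (intro card_subset_eq) auto
      have d1: "d p \<le> 1" if p: "p \<in> V" "p \<noteq> c" for p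
      proof -
        have "nbs V p \<subseteq> {c}"
        proof (rule ccontr)
          assume "\<not> nbs V p \<subseteq> {c}"
          then obtain x where x: "x \<in> V" "R p x" "x \<noteq> c" by (auto simp: nbs_def)
          have "R c p" "R c x" using Nc p x by (auto simp: nbs_def)
          then have "clique {c, p, x}" using x sym by (auto simp: clique_def)
          moreover have "{c, p, x} \<subseteq> V" using p x 4 by auto
          ultimately have "card {c, p, x} \<le> r" using cn unfolding clique_number_le_def by blast
          moreover have "p \<noteq> x" using x irrefl by auto
          ultimately show False using 4 p x by auto
        qed
        then have "card (nbs V p) \<le> card {c}" by (intro card_mono) auto
        then show ?thesis by (simp add: d_def)
      qed
      have cardV: "real (card (V - {c})) = y - 1"
        using 4 fin m by (simp add: y_def of_nat_diff)
      \<comment> \<open>A leaf has one neighbour, hence two choices per free vertex and at most 3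
        maps of the edge \<open>W\<close>. This is below \<open>K\<close>, whose base
        \<open>y + 1\<close> is at least 6.\<close>
      have two: "3 * 2 ^ (card V - r) \<le> K"
      proof -
        have "(3 :: real) * 2 ^ (card V - r) \<le> 3 ^ (card V - r) * 2 ^ (card V - r)"
          using 4 m self_le_power[of "3 :: real" "card V - r"] by (intro mult_right_mono) auto
        also have "\<dots> = 6 ^ (card V - r)" by (simp add: power_mult_distrib[symmetric])
        also have "\<dots> \<le> K" unfolding K_def using y by (intro power_mono) auto
        finally show ?thesis .
      qed
      have "real (card (homs V R (nbs V c))) \<le> clique_bound 1 r (d c) * K"
        unfolding K_def
        by (rule hp') (use 4 d[of c] y in \<open>auto intro!: power_mono\<close>)
      also have "\<dots> \<le> (2 * y - 1) * K"
        using 4 d[of c] K(1) by (intro mult_right_mono) (auto simp: clique_bound_small[simplified])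
      finally have hc: "real (card (homs V R (nbs V c))) \<le> (2 * y - 1) * K" .
      have hother: "real (card (homs V R (nbs V p))) \<le> K" if p: "p \<in> V - {c}" for p
      proof -
        have "real (card (homs V R (nbs V p))) \<le> clique_bound 1 r (d p) * 2 ^ (card V - r)"
          using p d1[of p] d[of p] 4 by (intro hp') (auto intro!: power_mono)
        also have "\<dots> \<le> 3 * 2 ^ (card V - r)"
          using p d1[of p] 4 by (intro mult_right_mono) (auto simp: clique_bound_small[simplified])
        finally show ?thesis using two by linarith
      qed
      have sumV: "(\<Sum>p\<in>V. f p) = f c + (\<Sum>p\<in>V - {c}. f p)" for f :: "'v \<Rightarrow> real"
        using 4 fin by (simp add: sum.remove)
      have "(\<Sum>p\<in>V - {c}. real (card (homs V R (nbs V p)))) \<le> (y - 1) * K"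
        using sum_bounded_above[of "V - {c}" _ K, OF hother] cardV by simp
      with hc have *: "(\<Sum>p\<in>V. real (card (homs V R (nbs V p)))) \<le> (3 * y - 2) * K"
        unfolding sumV by (simp add: algebra_simps)
      have "(\<Sum>p\<in>V - {c}. d p) \<le> y - 1"
        using sum_bounded_above[of "V - {c}" d 1] d1 cardV by simp
      then have D: "(\<Sum>p\<in>V. d p) \<le> 2 * (y - 1)"
        unfolding sumV using d[of c] 4 by simp
      obtain v w where vw: "W = {v, w}" "v \<noteq> w"
        using 4 unfolding r_def by (auto simp: card_2_iff)
      have "real (card (clique_homs W V)) = 1 + 2 * y + (\<Sum>p\<in>V. d p)"
        using card_clique_homs_pair[OF fin e vw(2)] unfolding vw(1) by (simp add: y_def d_def)
      then have "real (card (homs V R V)) \<le> (1 + 2 * y + 2 * (y - 1)) * K"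
        using hV D K(1) by (smt (verit) mult_right_mono)
      with * have "real (card (homs V R V)) + (\<Sum>p\<in>V. real (card (homs V R (nbs V p))))
          \<le> (7 * y - 3) * K"
        by (simp add: algebra_simps)
      also have "\<dots> \<le> (y + 1) ^ 2 * K"
      proof (rule mult_right_mono)
        have "5 * y \<le> y\<^sup>2" using y by (auto simp: power2_eq_square)
        then show "7 * y - 3 \<le> (y + 1)\<^sup>2" by (simp add: power2_eq_square algebra_simps)
      qed (use K in simp)
      finally show ?thesis unfolding 4 .
    qed
  qed
  then have "real (card (homs V R V) + (\<Sum>p\<in>V. card (homs V R (nbs V p))))
      \<le> real ((card V + 1) ^ card V)"
    unfolding K(2) by (simp add: y_def add.commute)
  then show ?thesis by (simp only: of_nat_le_iff)
qed

end

section \<open>Suffix-free automata\<close>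

lemma delta_star_append: "delta_star \<delta> q (u @ v) = delta_star \<delta> (delta_star \<delta> q u) v"
  by (induction u arbitrary: q) auto

locale suffix_free_dfa =
  fixes Q :: "'q set" and \<Sigma> :: "'a set" and \<delta> :: "'q \<Rightarrow> 'a \<Rightarrow> 'q"
    and q0 :: 'q and F :: "'q set"
  assumes complete: "complete_dfa Q \<Sigma> \<delta> q0 F"
    and minimal: "minimal_dfa Q \<Sigma> \<delta> q0 F"
    and suffix_free: "suffix_free (dfa_lang \<Sigma> \<delta> q0 F)"
    and nontrivial: "2 \<le> card Q"
begin

abbreviation run :: "'a list \<Rightarrow> 'q \<Rightarrow> 'q" where
  "run w q \<equiv> delta_star \<delta> q w"

section \<open>The empty state and the initial state\<close>

definition dead :: "'q \<Rightarrow> bool" where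
  "dead q \<longleftrightarrow> (\<forall>w. set w \<subseteq> \<Sigma> \<longrightarrow> run w q \<notin> F)"

lemma finite_Q: "finite Q" and finite_Sigma: "finite \<Sigma>" and q0_in: "q0 \<in> Q"
  using complete by (auto simp: complete_dfa_def)

lemma run_in: "q \<in> Q \<Longrightarrow> set w \<subseteq> \<Sigma> \<Longrightarrow> run w q \<in> Q"
  using complete by (induction w arbitrary: q) (auto simp: complete_dfa_def)

lemma dead_unique: "p \<in> Q \<Longrightarrow> q \<in> Q \<Longrightarrow> dead p \<Longrightarrow> dead q \<Longrightarrow> p = q"
  using minimal unfolding minimal_dfa_def dead_def by blast

lemma dead_run: "dead q \<Longrightarrow> set w \<subseteq> \<Sigma> \<Longrightarrow> dead (run w q)"
  unfolding dead_def by (metis delta_star_append le_sup_iff set_append)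

lemma reach: "q \<in> Q \<Longrightarrow> \<exists>w. set w \<subseteq> \<Sigma> \<and> run w q0 = q"
  using minimal by (auto simp: minimal_dfa_def)

lemma not_dead_q0: "\<not> dead q0"
proof
  assume "dead q0"
  then have "dead q" if "q \<in> Q" for q using reach[OF that] dead_run by blast
  then have "Q \<subseteq> {q0}" using dead_unique q0_in by blast
  then have "card Q \<le> card {q0}" by (intro card_mono) auto
  then show False using nontrivial by simp
qed

text \<open>If both \<open>x @ y\<close> and \<open>u @ x @ y\<close> were accepted, the language would not be suffix-free.\<close>

lemma dead_if_focused:
  assumes "set u \<subseteq> \<Sigma>" "u \<noteq> []" "set x \<subseteq> \<Sigma>" "run (u @ x) q0 = run x q0"
  shows "dead (run x q0)"
  unfolding dead_def
proof (intro allI impI notI)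
  fix y assume y: "set y \<subseteq> \<Sigma>" "run y (run x q0) \<in> F"
  have "x @ y \<in> dfa_lang \<Sigma> \<delta> q0 F" "u @ x @ y \<in> dfa_lang \<Sigma> \<delta> q0 F"
    using assms y by (auto simp: dfa_lang_def delta_star_append)
  then have "x @ y = u @ x @ y"
    using suffix_free unfolding suffix_free_def by (metis suffixI)
  then show False using assms(2) by simp
qed

text \<open>A nonempty loop at the initial state would make it dead, by
  \<open>dead_if_focused\<close> with \<open>x\<close> empty.\<close>

lemma run_neq_q0:
  assumes "q \<in> Q" "set w \<subseteq> \<Sigma>" "w \<noteq> []"
  shows "run w q \<noteq> q0"
proof
  assume w: "run w q = q0"
  obtain u where u: "set u \<subseteq> \<Sigma>" "run u q0 = q" using reach[OF assms(1)] by blast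
  have "dead (run [] q0)"
    by (rule dead_if_focused[of "u @ w"]) (use assms u w in \<open>auto simp: delta_star_append\<close>)
  then show False using not_dead_q0 by simp
qed

text \<open>A state \<open>q\<close> other than \<open>q0\<close> is reached by some nonempty
  \<open>u\<close>; then \<open>w\<close> and \<open>u @ w\<close> lead from \<open>q0\<close> to
  the same state.\<close>

lemma dead_if_merged_with_q0:
  assumes "q \<in> Q" "q \<noteq> q0" "set w \<subseteq> \<Sigma>" "run w q = run w q0"
  shows "dead (run w q)"
proof -
  obtain u where u: "set u \<subseteq> \<Sigma>" "run u q0 = q" using reach[OF assms(1)] by blast
  have "u \<noteq> []" using u assms(2) by auto
  then have "dead (run w q0)"
    using u assms by (intro dead_if_focused[of u]) (auto simp: delta_star_append)
  then show ?thesis using assms by simp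
qed

text \<open>The states reached by the powers of one letter must repeat, and a state reached by both
  a word and a proper extension of it to the left is dead.\<close>

lemma ex_dead: "\<exists>q\<in>Q. dead q"
proof -
  have "\<exists>q\<in>Q. q \<noteq> q0"
  proof (rule ccontr)
    assume "\<not> ?thesis"
    then have "card Q \<le> card {q0}" by (intro card_mono) auto
    then show False using nontrivial by simp
  qed
  then obtain q where q: "q \<in> Q" "q \<noteq> q0" by blast
  obtain w where w: "set w \<subseteq> \<Sigma>" "run w q0 = q" using reach[OF q(1)] by blast
  then obtain a where a: "a \<in> \<Sigma>" using q by (cases w) auto
  let ?f = "\<lambda>i. run (replicate i a) q0"
  have in_Q: "?f i \<in> Q" for i using a q0_in by (intro run_in) auto
  have "\<not> inj ?f"
  proof
    assume "inj ?f"
    then have "infinite (range ?f)" using finite_imageD infinite_UNIV_nat by blast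
    moreover have "range ?f \<subseteq> Q" using in_Q by auto
    ultimately show False using finite_Q finite_subset by blast
  qed
  then obtain i j where ij: "i < j" "?f i = ?f j"
    unfolding inj_def by (metis linorder_neqE_nat)
  have "dead (?f i)"
  proof (rule dead_if_focused[of "replicate (j - i) a"])
    show "run (replicate (j - i) a @ replicate i a) q0 = ?f i"
      using ij by (simp add: replicate_add[symmetric])
  qed (use ij a in auto)
  then show ?thesis using in_Q by blast
qed

definition sink :: 'q where
  "sink = (SOME q. q \<in> Q \<and> dead q)"

lemma sink: "sink \<in> Q" "dead sink"
  using someI_ex[of "\<lambda>q. q \<in> Q \<and> dead q"] ex_dead unfolding sink_def by blast+

lemma dead_imp_sink: "q \<in> Q \<Longrightarrow> dead q \<Longrightarrow> q = sink"
  using dead_unique sink by blast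

lemma run_sink: "set w \<subseteq> \<Sigma> \<Longrightarrow> run w sink = sink"
  using dead_imp_sink dead_run run_in sink by blast

lemma sink_neq_q0: "sink \<noteq> q0"
  using sink not_dead_q0 by auto

section \<open>The collision graph\<close>

definition M :: "'q set" where
  "M = Q - {q0, sink}"

lemma finite_M: "finite M" and sink_notin_M: "sink \<notin> M" and M_subset: "M \<subseteq> Q"
  and q0_notin_M: "q0 \<notin> M"
  using finite_Q by (auto simp: M_def)

lemma card_M: "card M = card Q - 2"
  unfolding M_def using sink q0_in sink_neq_q0 finite_Q by (subst card_Diff_subset) auto

definition words :: "'a list set" where
  "words = {w. w \<noteq> [] \<and> set w \<subseteq> \<Sigma>}"

lemma run_in_M: "w \<in> words \<Longrightarrow> q \<in> Q \<Longrightarrow> run w q \<in> insert sink M"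
  using run_in run_neq_q0 by (auto simp: M_def words_def)

definition collides :: "'q \<Rightarrow> 'q \<Rightarrow> bool" where
  "collides p q \<longleftrightarrow> p \<in> M \<and> q \<in> M \<and>
     (\<exists>w\<in>words. \<exists>r\<in>M. run w q0 = p \<and> run w r = q \<or> run w q0 = q \<and> run w r = p)"

lemma collision: "w \<in> words \<Longrightarrow> r \<in> M \<Longrightarrow> run w q0 \<in> M \<Longrightarrow> run w r \<in> M \<Longrightarrow>
    collides (run w q0) (run w r)"
  by (auto simp: collides_def)

lemma collides_sym: "collides p q \<Longrightarrow> collides q p"
  unfolding collides_def by blast

text \<open>A word merging \<open>q0\<close> with a state of \<open>M\<close> can do so only in the
  empty state, which is not in \<open>M\<close>.\<close>

lemma collides_irrefl: "\<not> collides p p"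
proof
  assume "collides p p"
  then obtain w r where w: "w \<in> words" "r \<in> M" "run w q0 = p" "run w r = p" "p \<in> M"
    by (auto simp: collides_def)
  then have "dead (run w r)"
    using M_subset q0_notin_M by (intro dead_if_merged_with_q0) (auto simp: words_def)
  then show False
    using w dead_imp_sink M_subset sink_notin_M by auto
qed

sublocale collision_graph collides sink
  by unfold_locales (auto simp: collides_sym collides_irrefl)

text \<open>If \<open>u\<close> witnesses the collision of \<open>p\<close> and \<open>q\<close>,
  then \<open>u @ w\<close> witnesses that of their images, as long as both stay in
  \<open>M\<close>.\<close>

lemma collides_run:
  assumes "collides p q" "w \<in> words"
  shows "run w p = sink \<or> run w q = sink \<or> collides (run w p) (run w q)"
proof -
  have *: "run w (run u q0) = sink \<or> run w (run u r) = sink \<or>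
      collides (run w (run u q0)) (run w (run u r))"
    if u: "u \<in> words" "r \<in> M" "run u q0 \<in> M" "run u r \<in> M" for u r
  proof -
    have "u @ w \<in> words" using u assms by (auto simp: words_def)
    then show ?thesis
      using collision[of "u @ w" r] run_in_M[OF assms(2)] u M_subset
      by (auto simp: delta_star_append subset_iff)
  qed
  obtain u r where u: "u \<in> words" "r \<in> M" "p \<in> M" "q \<in> M"
    "run u q0 = p \<and> run u r = q \<or> run u q0 = q \<and> run u r = p"
    using assms(1) by (auto simp: collides_def)
  then show ?thesis using *[OF u(1,2)] collides_sym by blast
qed

section \<open>Words as homomorphisms of the cone\<close>

text \<open>The first component is the image of the apex \<open>q0\<close>; when it lies in
  \<open>M\<close>, all other images must be \<open>sink\<close> or collide with it.\<close>

definition profiles :: "('q \<times> ('q \<Rightarrow> 'q)) set" where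
  "profiles = (SIGMA p:insert sink M. homs M collides (if p = sink then M else nbs M p))"

definition profile :: "'a list \<Rightarrow> 'q \<times> ('q \<Rightarrow> 'q)" where
  "profile w = (run w q0, restrict (\<lambda>q. run w q) M)"

lemma profile_in_profiles:
  assumes "w \<in> words"
  shows "profile w \<in> profiles"
proof -
  have p: "run w q0 \<in> insert sink M" by (rule run_in_M[OF assms q0_in])
  have im: "run w q \<in> insert sink M" if "q \<in> M" for q
    using run_in_M[OF assms] that M_subset by auto
  have "run w q \<in> insert sink (nbs M (run w q0))" if "q \<in> M" "run w q0 \<noteq> sink" for q
    using p im[OF that(1)] collision[OF assms that(1)] that by (auto simp: nbs_def)
  then have "restrict (\<lambda>q. run w q) M \<in> M \<rightarrow>\<^sub>E insert sink (if run w q0 = sink then M else nbs M (run w q0))"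
    using im by auto
  moreover have "\<forall>i\<in>M. \<forall>j\<in>M. collides i j \<longrightarrow>
      run w i = sink \<or> run w j = sink \<or> collides (run w i) (run w j)"
    using collides_run[OF _ assms] by blast
  ultimately show ?thesis
    using p unfolding profiles_def profile_def homs_def mem_Sigma_iff by simp
qed

lemma trans_semigroup_eq: "trans_semigroup Q \<Sigma> \<delta> = (\<lambda>w. restrict (\<lambda>q. run w q) Q) ` words"
  by (auto simp: trans_semigroup_def words_def)

text \<open>Every word fixes \<open>sink\<close>, so its transformation can be recovered from its
  action on \<open>q0\<close> and on \<open>M\<close>.\<close>

lemma card_trans_semigroup: "card (trans_semigroup Q \<Sigma> \<delta>) \<le> card (profile ` words)"
proof -
  have fin: "finite (profile ` words)"
  proof (rule finite_subset)
    show "profile ` words \<subseteq> profiles" using profile_in_profiles by auto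
    show "finite profiles" unfolding profiles_def using finite_M by (intro finite_SigmaI) auto
  qed
  have "restrict (\<lambda>q. run w q) Q =
      (\<lambda>(p, f). restrict (\<lambda>q. if q = q0 then p else if q = sink then sink else f q) Q) (profile w)"
    if "w \<in> words" for w
  proof
    fix q
    have "run w sink = sink" using run_sink[of w] that by (simp add: words_def)
    moreover have "q \<in> M" if "q \<in> Q" "q \<noteq> q0" "q \<noteq> sink" using that by (simp add: M_def)
    ultimately show "restrict (\<lambda>q. run w q) Q q = (\<lambda>(p, f). restrict
        (\<lambda>q. if q = q0 then p else if q = sink then sink else f q) Q) (profile w) q"
      by (simp add: profile_def)
  qed
  then have "trans_semigroup Q \<Sigma> \<delta> \<subseteq>
      (\<lambda>(p, f). restrict (\<lambda>q. if q = q0 then p else if q = sink then sink else f q) Q) ` profile ` words"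
    unfolding trans_semigroup_eq by (intro image_subsetI image_eqI[OF _ imageI]) auto
  then show ?thesis using fin by (rule surj_card_le[rotated])
qed

lemma card_profiles: "card profiles = card (homs M collides M) + (\<Sum>p\<in>M. card (homs M collides (nbs M p)))"
proof -
  have "card profiles = (\<Sum>p\<in>insert sink M. card (homs M collides (if p = sink then M else nbs M p)))"
    unfolding profiles_def using finite_M by (intro card_SigmaI) auto
  also have "\<dots> = card (homs M collides M) + (\<Sum>p\<in>M. card (homs M collides (if p = sink then M else nbs M p)))"
    using finite_M sink_notin_M by simp
  also have "(\<Sum>p\<in>M. card (homs M collides (if p = sink then M else nbs M p)))
      = (\<Sum>p\<in>M. card (homs M collides (nbs M p)))"
    using sink_notin_M by (intro sum.cong) auto
  finally show ?thesis .
qed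

section \<open>Permutation letters and the need for five letters\<close>

definition bij_letter :: "'a \<Rightarrow> bool" where
  "bij_letter a \<longleftrightarrow> bij_betw (\<lambda>q. \<delta> q a) M M"

lemma step_in: "a \<in> \<Sigma> \<Longrightarrow> q \<in> M \<Longrightarrow> \<delta> q a \<in> insert sink M"
  using run_in_M[of "[a]" q] M_subset by (auto simp: words_def)

lemma bij_run: "\<forall>a\<in>set w. bij_letter a \<Longrightarrow> bij_betw (run w) M M"
proof (induction w)
  case Nil
  then show ?case by (simp add: bij_betw_def inj_on_def)
next
  case (Cons a w)
  then have "bij_betw (run w \<circ> (\<lambda>q. \<delta> q a)) M M"
    by (intro bij_betw_trans) (auto simp: bij_letter_def)
  then show ?case by (simp add: comp_def)
qed

lemma letter_bijI:
  assumes "inj_on (\<lambda>q. \<delta> q a) M" "\<And>q. q \<in> M \<Longrightarrow> \<delta> q a \<in> M"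
  shows "bij_letter a"
  unfolding bij_letter_def bij_betw_def
  using assms finite_M by (metis endo_inj_surj image_subsetI)

text \<open>The first letter must be injective on \<open>M\<close> and cannot reach the absorbing
  \<open>sink\<close>, so by finiteness it permutes \<open>M\<close>. It can then be stripped off
  without changing the hypotheses.\<close>

lemma bij_run_letters:
  assumes "set w \<subseteq> \<Sigma>" "inj_on (run w) M" "run w ` M \<subseteq> M"
  shows "\<forall>a\<in>set w. bij_letter a"
  using assms
proof (induction w)
  case (Cons a w)
  have im: "\<delta> q a \<in> M" if "q \<in> M" for q
    using step_in[of a q] Cons.prems that run_sink[of w] sink_notin_M by (auto simp: image_subset_iff)
  have inj: "inj_on (\<lambda>q. \<delta> q a) M"
    using Cons.prems(2) by (auto simp: inj_on_def)
  have a: "bij_letter a" using letter_bijI im inj by blast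
  then have eq: "(\<lambda>q. \<delta> q a) ` M = M" by (simp add: bij_letter_def bij_betw_def)
  have "run w ` (\<lambda>q. \<delta> q a) ` M \<subseteq> M"
    using Cons.prems(3) by (simp add: image_image)
  then have "run w ` M \<subseteq> M" unfolding eq .
  moreover have "inj_on (run w) M"
    using Cons.prems(2) by (subst eq[symmetric]) (auto simp: inj_on_def)
  ultimately show ?case using Cons a by auto
qed simp

lemma first_nonbij_letter:
  assumes "set w \<subseteq> \<Sigma>" "\<not> bij_betw (run w) M M"
  obtains u b v where "w = u @ b # v" "bij_betw (run u) M M" "b \<in> \<Sigma>" "\<not> bij_letter b"
proof -
  have "\<exists>a\<in>set w. \<not> bij_letter a" using bij_run assms by blast
  then obtain u b v where "w = u @ b # v" "\<not> bij_letter b" "\<forall>a\<in>set u. \<not> \<not> bij_letter a"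
    using split_list_first_prop[of w "\<lambda>a. \<not> bij_letter a"] by blast
  then show thesis using that[of u b v] bij_run[of u] assms by auto
qed

text \<open>Each non-permutation letter is the first one in a word for a suitable map. The prefix
  before it permutes \<open>M\<close>, so the letter inherits totality or injectivity on all of
  \<open>M\<close> from that map.\<close>

lemma five_letters:
  assumes no_collision: "\<And>p q. \<not> collides p q"
    and all: "\<And>f. f \<in> M \<rightarrow> insert sink M \<Longrightarrow> \<exists>w\<in>words. \<forall>q\<in>M. run w q = f q"
    and "3 \<le> card M"
  shows "5 \<le> card \<Sigma>"
proof -
  obtain x y z where xyz: "x \<in> M" "y \<in> M" "z \<in> M" "x \<noteq> y" "x \<noteq> z" "y \<noteq> z"
  proof -
    obtain T where "T \<subseteq> M" "card T = 3" using assms(3) by (rule obtain_subset_with_card_n)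
    then show thesis using that unfolding card_3_iff by blast
  qed
  let ?B = "{a \<in> \<Sigma>. bij_letter a}"
  have bij_word: "set w \<subseteq> ?B"
    if "w \<in> words" "\<forall>q\<in>M. run w q = f q" "inj_on f M" "f ` M \<subseteq> M" for w f
  proof -
    have w: "set w \<subseteq> \<Sigma>" using that(1) by (simp add: words_def)
    have "inj_on (run w) M" using that(2,3) by (simp add: inj_on_def)
    moreover have "run w ` M \<subseteq> M" using that(2,4) by auto
    ultimately show ?thesis using bij_run_letters[OF w] w by auto
  qed
  have "\<exists>a1\<in>?B. \<exists>a2\<in>?B. a1 \<noteq> a2"
  proof (rule ccontr)
    assume "\<not> ?thesis"
    then obtain a where a: "?B \<subseteq> {a}" by blast
    \<comment> \<open>Powers of a single letter commute, whereas these two transpositions, which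
      share \<open>y\<close>, do not.\<close>
    let ?f = "id(x := y, y := x)" and ?g = "id(y := z, z := y)"
    obtain v where v: "v \<in> words" "\<forall>q\<in>M. run v q = ?f q"
      using all[of ?f] xyz by fastforce
    obtain w where w: "w \<in> words" "\<forall>q\<in>M. run w q = ?g q"
      using all[of ?g] xyz by fastforce
    have "inj_on ?f M" "?f ` M \<subseteq> M" "inj_on ?g M" "?g ` M \<subseteq> M"
      using xyz by (auto simp: inj_on_def)
    then have "set v \<subseteq> {a}" "set w \<subseteq> {a}"
      using bij_word[OF v] bij_word[OF w] a by blast+
    then have "replicate (length v) a = v" "replicate (length w) a = w"
      by (blast intro: replicate_length_same)+
    then obtain i j where "v = replicate i a" "w = replicate j a" by metis
    then have "v @ w = w @ v" by (simp add: replicate_add[symmetric] add.commute)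
    then have "run w (run v x) = run v (run w x)" by (metis delta_star_append)
    then show False using v w xyz by auto
  qed
  then obtain a1 a2 where a12: "a1 \<in> \<Sigma>" "a2 \<in> \<Sigma>" "bij_letter a1" "bij_letter a2" "a1 \<noteq> a2" by auto
  obtain b where b: "b \<in> \<Sigma>" "\<not> bij_letter b" "\<And>q. q \<in> M \<Longrightarrow> \<delta> q b \<in> M"
  proof -
    let ?f = "id(x := y)"
    obtain w where w: "w \<in> words" "\<forall>q\<in>M. run w q = ?f q"
      using all[of ?f] xyz by fastforce
    have "\<not> bij_betw (run w) M M"
      using w xyz by (auto simp: bij_betw_def inj_on_def)
    then obtain u b v where b: "w = u @ b # v" "bij_betw (run u) M M" "b \<in> \<Sigma>" "\<not> bij_letter b"
      using first_nonbij_letter[of w] w by (auto simp: words_def)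
    have "\<delta> q b \<in> M" if "q \<in> M" for q
    proof -
      obtain q' where q': "q' \<in> M" "q = run u q'" using b(2) \<open>q \<in> M\<close> by (auto simp: bij_betw_def)
      have "run v (\<delta> q b) = ?f q'" using w q' b by (auto simp: delta_star_append)
      also have "?f q' \<in> M" using q' xyz by auto
      finally show ?thesis
        using step_in[OF b(3) that] run_sink[of v] w b sink_notin_M by (auto simp: words_def)
    qed
    then show thesis using that b by blast
  qed
  obtain b' where b': "b' \<in> \<Sigma>" "\<not> bij_letter b'" "inj_on (\<lambda>q. \<delta> q b') M"
  proof -
    let ?f = "id(x := sink)"
    obtain w where w: "w \<in> words" "\<forall>q\<in>M. run w q = ?f q"
      using all[of ?f] xyz by fastforce
    have "run w x = sink" using w xyz by auto
    then have "\<not> bij_betw (run w) M M"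
      using xyz(1) sink_notin_M by (metis bij_betwE)
    then obtain u b v where b: "w = u @ b # v" "bij_betw (run u) M M" "b \<in> \<Sigma>" "\<not> bij_letter b"
      using first_nonbij_letter[of w] w by (auto simp: words_def)
    have "inj_on ?f M" using sink_notin_M by (auto simp: inj_on_def)
    then have "inj_on (run w) M" using w inj_on_cong[of M "run w" ?f] by blast
    have "inj_on (\<lambda>q. \<delta> q b) M"
    proof (rule inj_onI)
      fix q r assume qr: "q \<in> M" "r \<in> M" "\<delta> q b = \<delta> r b"
      obtain q' r' where q': "q' \<in> M" "q = run u q'" "r' \<in> M" "r = run u r'"
      proof -
        have "q \<in> run u ` M" "r \<in> run u ` M"
          using b(2) qr(1,2) by (simp_all add: bij_betw_def)
        then show thesis using that by blast
      qed
      have "run w q' = run w r'"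
        using qr(3) unfolding b(1) q'(2) q'(4) by (simp add: delta_star_append)
      then have "q' = r'" using \<open>inj_on (run w) M\<close> q' by (simp add: inj_onD)
      then show "q = r" using q' by simp
    qed
    then show thesis using that b by blast
  qed
  obtain a where a: "a \<in> \<Sigma>" "\<delta> q0 a \<noteq> sink"
  proof -
    obtain w where w: "set w \<subseteq> \<Sigma>" "run w q0 = x" using reach xyz M_subset by blast
    moreover have "w \<noteq> []" using w xyz q0_notin_M by auto
    ultimately obtain a v where "w = a # v" by (cases w) auto
    then have "a \<in> \<Sigma>" "run v (\<delta> q0 a) = x" "run v sink = sink"
      using w run_sink[of v] by auto
    then show thesis using that[of a] xyz(1) sink_notin_M by metis
  qed
  \<comment> \<open>The letter \<open>a\<close> sends \<open>q0\<close> into \<open>M\<close>, so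
    any state of \<open>M\<close> that it kept in \<open>M\<close> would give a collision.\<close>
  have kill: "\<delta> q a = sink" if "q \<in> M" for q
    using collision[of "[a]" q] step_in[OF a(1) that] run_in_M[of "[a]" q0] q0_in a that no_collision
    by (auto simp: words_def)
  \<comment> \<open>A letter both total and injective on \<open>M\<close> would be a permutation
    letter, so \<open>b\<close> and \<open>b'\<close> differ. The letter \<open>a\<close> sends all
    of \<open>M\<close> to \<open>sink\<close>, which excludes totality, injectivity and being a
    permutation.\<close>
  have "b \<noteq> b'" using b b' letter_bijI by blast
  moreover have "a \<noteq> b" using b(3)[OF xyz(1)] kill[OF xyz(1)] sink_notin_M by auto
  moreover have "a \<noteq> b'" using inj_onD[OF b'(3) _ xyz(1,2)] kill xyz(1,2,4) by auto
  moreover have "\<not> bij_letter a"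
    using kill xyz(1) sink_notin_M unfolding bij_letter_def by (metis bij_betwE)
  ultimately have "distinct [a1, a2, b, b', a]"
    using a12(3-5) b(2) b'(2) by auto
  then have "card {a1, a2, b, b', a} = 5"
    using distinct_card[of "[a1, a2, b, b', a]"] by simp
  moreover have "{a1, a2, b, b', a} \<subseteq> \<Sigma>" using a12 a b b' by auto
  ultimately show ?thesis using card_mono[OF finite_Sigma] by metis
qed

section \<open>The strict bound\<close>

lemma card_trans_semigroup_less:
  assumes "7 \<le> card Q" "card \<Sigma> < 5"
  shows "card (trans_semigroup Q \<Sigma> \<delta>) < (card M + 1) ^ card M + card M"
proof -
  have m: "5 \<le> card M" using assms card_M by simp
  have sub: "profile ` words \<subseteq> profiles" using profile_in_profiles by auto
  have fin: "finite profiles" unfolding profiles_def using finite_M by (intro finite_SigmaI) auto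
  have le: "card (trans_semigroup Q \<Sigma> \<delta>) \<le> card (profile ` words)" by (rule card_trans_semigroup)
  show ?thesis
  proof (cases "\<exists>p q. collides p q")
    case True
    then obtain p q where pq: "p \<in> M" "q \<in> M" "collides p q" by (auto simp: collides_def)
    have "card (profile ` words) \<le> card profiles" using fin sub by (rule card_mono)
    also have "\<dots> \<le> (card M + 1) ^ card M"
      unfolding card_profiles by (rule card_homs_total_le[OF finite_M sink_notin_M m pq])
    finally show ?thesis using le m by linarith
  next
    case False
    \<comment> \<open>Without collisions an apex sent into \<open>M\<close> forces everything else
      to \<open>sink\<close>, so these profiles add at most one for each state of
      \<open>M\<close>.\<close>
    have "nbs M p = {}" for p using False by (auto simp: nbs_def)
    then have "card (homs M collides (nbs M p)) \<le> 1" for p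
      using card_homs_le[OF finite_M, of "{}"] by simp
    then have "(\<Sum>p\<in>M. card (homs M collides (nbs M p))) \<le> card M"
      using sum_bounded_above[of M "\<lambda>p. card (homs M collides (nbs M p))" 1] by simp
    then have total: "card profiles \<le> (card M + 1) ^ card M + card M"
      unfolding card_profiles using card_homs_le[OF finite_M finite_M, of collides] by linarith
    have "profile ` words \<noteq> profiles"
    proof
      assume eq: "profile ` words = profiles"
      have "5 \<le> card \<Sigma>"
      proof (rule five_letters)
        fix f assume f: "f \<in> M \<rightarrow> insert sink M"
        \<comment> \<open>Sending the apex to \<open>sink\<close> leaves the map on \<open>M\<close>
          arbitrary, so if all profiles occurred, every map from \<open>M\<close> to
          \<open>insert sink M\<close> would be induced by a word.\<close>
        have "(sink, restrict f M) \<in> profiles"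
          using f False by (auto simp: profiles_def homs_def)
        then obtain w where w: "w \<in> words" "(sink, restrict f M) = profile w"
          unfolding eq[symmetric] by auto
        then have "restrict f M = restrict (run w) M" by (simp add: profile_def)
        then have "\<forall>q\<in>M. run w q = f q" by (metis restrict_apply')
        then show "\<exists>w\<in>words. \<forall>q\<in>M. run w q = f q" using w by blast
      qed (use False m in auto)
      then show False using assms by simp
    qed
    then have "card (profile ` words) < card profiles"
      using fin sub by (intro psubset_card_mono) auto
    then show ?thesis using le total by linarith
  qed
qed

end

theorem theorem2:
  fixes Q :: "'q set" and \<Sigma> :: "'a set" and \<delta> :: "'q \<Rightarrow> 'a \<Rightarrow> 'q"
    and q0 :: 'q and F :: "'q set" and n :: nat
  assumes "n \<ge> 7"
    and "complete_dfa Q \<Sigma> \<delta> q0 F"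
    and "card Q = n"
    and "minimal_dfa Q \<Sigma> \<delta> q0 F"
    and "suffix_free (dfa_lang \<Sigma> \<delta> q0 F)"
    and "card \<Sigma> < 5"
  shows "card (trans_semigroup Q \<Sigma> \<delta>) < (n - 1) ^ (n - 2) + n - 2"
proof -
  interpret suffix_free_dfa Q \<Sigma> \<delta> q0 F
    using assms by unfold_locales auto
  have "card M = n - 2" "card M + 1 = n - 1" using card_M assms(1,3) by auto
  then show ?thesis using card_trans_semigroup_less assms(1,3,6) by simp
qed

end
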